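(* Let $G$ be a $2$-step nilpotent Lie group endowed with a left-invariant complex structure $J$ and a left-invariant Hermitian metric $g_0$ on $(G,J)$ which is Strominger Kähler-like. Let $g_t$ be the (left-invariant) solution to the pluriclosed flow starting from $g_0$. Then $g_t$ is Strominger Kähler-like for every $t$ (for which the solution is defined).
   Context: Let $(M,J,g)$ be a Hermitian manifold, with fundamental form $\omega(\cdot,\cdot)=g(J\cdot,\cdot)$. The Bismut (or Strominger) connection $\nabla^B$ is the unique connection with $\nabla^B g=0$, $\nabla^B J=0$ whose torsion $T^B$, regarded as the $(3,0)$-tensor $T^B(x,y,z)=g(T^B(x,y),z)$, is totally skew-symmetric. Let $R^B(x,y)z=\nabla^B_x\nabla^B_y z-\nabla^B_y\nabla^B_x z-\nabla^B_{[x,y]}z$ be its curvature, also written $R^B(x,y,z)=R^B(x,y)z$. The metric $g$ is called Strominger Kähler-like if for all tangent vectors $x,y,z$: (i) $R^B(x,y,z)+R^B(y,z,x)+R^B(z,x,y)=0$, and (ii) $R^B(x,y,z)=R^B(Jx,Jy,z)$. Equivalently (a known result), $g$ is pluriclosed (i.e. $dJd\omega=0$) and $\nabla^BT^B=0$. The Bismut Ricci form is $\rho^B(x,y)=\frac12\sum_i g(R^B(x,y)Je_i,e_i)$, where $\{e_i\}$ is a local $g$-orthonormal frame of $TM$ (with this sign it is the usual Ricci form in the Kähler case). The pluriclosed flow starting from a pluriclosed metric $g_0$ with fundamental form $\omega_0$ is the evolution equation $\frac{\partial}{\partial t}\omega_t=-(\rho^B_{g_t})^{1,1}$ with $\omega_t|_{t=0}=\omega_0$,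 where $J$ is fixed, $\omega_t=g_t(J\cdot,\cdot)$, $\rho^B_{g_t}$ is the Bismut Ricci form of $g_t$ and $\alpha^{1,1}(x,y)=\frac12(\alpha(x,y)+\alpha(Jx,Jy))$ for a $2$-form $\alpha$. For left-invariant initial data on a Lie group one considers the left-invariant solution, i.e. the flow is an ODE on the Lie algebra, which has a unique solution on a maximal interval of existence. A Lie group is $2$-step nilpotent if its Lie algebra $\mathfrak g$ satisfies $[[\mathfrak g,\mathfrak g],\mathfrak g]=0$. *)

theory Defs
  imports "HOL-Analysis.Analysis"
begin

text \<open>
  Left-invariant tensor fields on a Lie group are determined by their values on the Lie algebra, and
  a left-invariant affine connection is determined by the product \<open>D x y = \<nabla>\<^sub>x y\<close> it induces on
  left-invariant vector fields. All notions below are those of the left-invariant geometry of a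
  Lie group, written on left-invariant vector fields. The Lie algebra is a bracket \<open>br\<close> on a
  finite-dimensional real vector space \<open>'a\<close>; the inner product that \<open>'a\<close> carries by virtue of
  its type class is never used, and metrics are separate bilinear forms \<open>g\<close>.
\<close>

definition lie_algebra :: "('a::euclidean_space \<Rightarrow> 'a \<Rightarrow> 'a) \<Rightarrow> bool" where
  "lie_algebra br \<longleftrightarrow> bilinear br \<and> (\<forall>x. br x x = 0) \<and>
     (\<forall>x y z. br x (br y z) + br y (br z x) + br z (br x y) = 0)"

definition two_step_nilpotent :: "('a::euclidean_space \<Rightarrow> 'a \<Rightarrow> 'a) \<Rightarrow> bool" where
  "two_step_nilpotent br \<longleftrightarrow> (\<forall>x y z. br (br x y) z = 0)"

text \<open>An almost complex structure with vanishing Nijenhuis tensor.\<close>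

definition complex_structure ::
    "('a::euclidean_space \<Rightarrow> 'a \<Rightarrow> 'a) \<Rightarrow> ('a \<Rightarrow> 'a) \<Rightarrow> bool" where
  "complex_structure br J \<longleftrightarrow> linear J \<and> (\<forall>x. J (J x) = - x) \<and>
     (\<forall>x y. br (J x) (J y) - J (br (J x) y) - J (br x (J y)) - br x y = 0)"

definition hermitian_metric ::
    "('a::euclidean_space \<Rightarrow> 'a) \<Rightarrow> ('a \<Rightarrow> 'a \<Rightarrow> real) \<Rightarrow> bool" where
  "hermitian_metric J g \<longleftrightarrow> bilinear g \<and> (\<forall>x y. g x y = g y x) \<and>
     (\<forall>x. x \<noteq> 0 \<longrightarrow> g x x > 0) \<and> (\<forall>x y. g (J x) (J y) = g x y)"

definition fundamental_form ::
    "('a::euclidean_space \<Rightarrow> 'a) \<Rightarrow> ('a \<Rightarrow> 'a \<Rightarrow> real) \<Rightarrow> 'a \<Rightarrow> 'a \<Rightarrow> real" where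
  "fundamental_form J g x y = g (J x) y"

definition torsion ::
    "('a::euclidean_space \<Rightarrow> 'a \<Rightarrow> 'a) \<Rightarrow> ('a \<Rightarrow> 'a \<Rightarrow> 'a) \<Rightarrow> 'a \<Rightarrow> 'a \<Rightarrow> 'a" where
  "torsion br D x y = D x y - D y x - br x y"

text \<open>
  The conditions on \<open>D\<close> are \<open>\<nabla>g = 0\<close>, \<open>\<nabla>J = 0\<close> and total skew-symmetry of \<open>g (T x y) z\<close>. In
  \<open>\<nabla>g = 0\<close> the term \<open>x (g y z)\<close> is absent because \<open>g y z\<close> is a constant function for
  left-invariant \<open>y\<close> and \<open>z\<close>.
\<close>

definition is_bismut_connection ::
    "('a::euclidean_space \<Rightarrow> 'a \<Rightarrow> 'a) \<Rightarrow> ('a \<Rightarrow> 'a) \<Rightarrow> ('a \<Rightarrow> 'a \<Rightarrow> real) \<Rightarrow>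
     ('a \<Rightarrow> 'a \<Rightarrow> 'a) \<Rightarrow> bool" where
  "is_bismut_connection br J g D \<longleftrightarrow> bilinear D \<and>
     (\<forall>x y z. g (D x y) z + g y (D x z) = 0) \<and>
     (\<forall>x y. D x (J y) = J (D x y)) \<and>
     (\<forall>x y z. g (torsion br D x y) z = - g (torsion br D y x) z) \<and>
     (\<forall>x y z. g (torsion br D x y) z = - g (torsion br D x z) y)"

definition bismut_connection ::
    "('a::euclidean_space \<Rightarrow> 'a \<Rightarrow> 'a) \<Rightarrow> ('a \<Rightarrow> 'a) \<Rightarrow> ('a \<Rightarrow> 'a \<Rightarrow> real) \<Rightarrow>
     'a \<Rightarrow> 'a \<Rightarrow> 'a" where
  "bismut_connection br J g = (THE D. is_bismut_connection br J g D)"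

definition curvature ::
    "('a::euclidean_space \<Rightarrow> 'a \<Rightarrow> 'a) \<Rightarrow> ('a \<Rightarrow> 'a \<Rightarrow> 'a) \<Rightarrow> 'a \<Rightarrow> 'a \<Rightarrow> 'a \<Rightarrow> 'a" where
  "curvature br D x y z = D x (D y z) - D y (D x z) - D (br x y) z"

definition bismut_curvature ::
    "('a::euclidean_space \<Rightarrow> 'a \<Rightarrow> 'a) \<Rightarrow> ('a \<Rightarrow> 'a) \<Rightarrow> ('a \<Rightarrow> 'a \<Rightarrow> real) \<Rightarrow>
     'a \<Rightarrow> 'a \<Rightarrow> 'a \<Rightarrow> 'a" where
  "bismut_curvature br J g = curvature br (bismut_connection br J g)"

definition strominger_kahler_like ::
    "('a::euclidean_space \<Rightarrow> 'a \<Rightarrow> 'a) \<Rightarrow> ('a \<Rightarrow> 'a) \<Rightarrow> ('a \<Rightarrow> 'a \<Rightarrow> real) \<Rightarrow> bool" where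
  "strominger_kahler_like br J g \<longleftrightarrow>
     (let R = bismut_curvature br J g in
        (\<forall>x y z. R x y z + R y z x + R z x y = 0) \<and>
        (\<forall>x y z. R x y z = R (J x) (J y) z))"

definition orthonormal_frame ::
    "('a::euclidean_space \<Rightarrow> 'a \<Rightarrow> real) \<Rightarrow> 'a set \<Rightarrow> bool" where
  "orthonormal_frame g B \<longleftrightarrow> finite B \<and> span B = UNIV \<and>
     (\<forall>b\<in>B. \<forall>c\<in>B. g b c = (if b = c then 1 else 0))"

text \<open>The sum is a trace, so it does not depend on the orthonormal frame that is chosen.\<close>

definition bismut_ricci_form ::
    "('a::euclidean_space \<Rightarrow> 'a \<Rightarrow> 'a) \<Rightarrow> ('a \<Rightarrow> 'a) \<Rightarrow> ('a \<Rightarrow> 'a \<Rightarrow> real) \<Rightarrow>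
     'a \<Rightarrow> 'a \<Rightarrow> real" where
  "bismut_ricci_form br J g x y =
     1/2 * (\<Sum>e\<in>(SOME B. orthonormal_frame g B). g (bismut_curvature br J g x y (J e)) e)"

definition part_1_1 ::
    "('a::euclidean_space \<Rightarrow> 'a) \<Rightarrow> ('a \<Rightarrow> 'a \<Rightarrow> real) \<Rightarrow> 'a \<Rightarrow> 'a \<Rightarrow> real" where
  "part_1_1 J \<alpha> x y = 1/2 * (\<alpha> x y + \<alpha> (J x) (J y))"

text \<open>
  A solution \<open>g\<close> on an interval \<open>I\<close> containing \<open>0\<close>. Since \<open>I\<close> is arbitrary, the maximal solution
  is included. At an endpoint belonging to \<open>I\<close> the derivative is one-sided.
\<close>

definition pluriclosed_flow ::
    "('a::euclidean_space \<Rightarrow> 'a \<Rightarrow> 'a) \<Rightarrow> ('a \<Rightarrow> 'a) \<Rightarrow> ('a \<Rightarrow> 'a \<Rightarrow> real) \<Rightarrow>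
     real set \<Rightarrow> (real \<Rightarrow> 'a \<Rightarrow> 'a \<Rightarrow> real) \<Rightarrow> bool" where
  "pluriclosed_flow br J g\<^sub>0 I g \<longleftrightarrow>
     is_interval I \<and> 0 \<in> I \<and> g 0 = g\<^sub>0 \<and>
     (\<forall>t\<in>I. hermitian_metric J (g t)) \<and>
     (\<forall>t\<in>I. \<forall>x y.
        ((\<lambda>s. fundamental_form J (g s) x y) has_real_derivative
           - part_1_1 J (bismut_ricci_form br J (g t)) x y) (at t within I))"

end

theory Submission
  imports Defs
begin

text \<open>
  Let \<open>j z\<close> be defined by \<open>g (j z x) y = g z [x, y]\<close>. On a 2-step nilpotent Lie algebra the Bianchi
  identity alone forces \<open>J\<close> to be abelian, \<open>[Jx, Jy] = [x, y]\<close>; then \<open>\<nabla>\<^sup>B\<^sub>x y = - j x y\<close>, and being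
  Strominger Kaehler-like means that (A) all \<open>j x\<close> commute and (B) the cyclic sum of
  \<open>g [x, y] [u, v]\<close> over \<open>x, y, u\<close> vanishes. The Bismut Ricci form is \<open>g w [x, y]\<close> for some \<open>w\<close>, so
  along the flow \<open>g\<^sub>t x [u, v]\<close> is constant, which preserves (B). By (A) at time 0, each \<open>j\<^sub>0 z\<close> stays
  \<open>g\<^sub>t\<close>-skew. Hence, if \<open>g\<^sub>t = g\<^sub>0 (h _) _\<close>, then \<open>h\<close> commutes with all \<open>j\<^sub>0 z\<close>, and as \<open>h j\<^sub>t = j\<^sub>0\<close>,
  the \<open>j\<^sub>t z\<close> commute as well. No uniqueness theorem for the flow is needed.
\<close>

section \<open>Linear algebra for an arbitrary scalar product \<open>g\<close>\<close>

locale scalar_product =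
  fixes g :: "'a::euclidean_space \<Rightarrow> 'a \<Rightarrow> real"
  assumes bilinear_g: "bilinear g"
    and g_sym: "g x y = g y x"
    and pos: "x \<noteq> 0 \<Longrightarrow> g x x > 0"
begin

lemmas g_simps =
  bilinear_ladd[OF bilinear_g] bilinear_radd[OF bilinear_g]
  bilinear_lsub[OF bilinear_g] bilinear_rsub[OF bilinear_g]
  bilinear_lneg[OF bilinear_g] bilinear_rneg[OF bilinear_g]
  bilinear_lmul[OF bilinear_g] bilinear_rmul[OF bilinear_g]
  bilinear_lzero[OF bilinear_g] bilinear_rzero[OF bilinear_g]

lemma linear_g: "linear (g x)" "linear (\<lambda>x. g x y)"
  using bilinear_g by (auto simp: bilinear_def)

lemma g_self_eq_0_iff [simp]: "g x x = 0 \<longleftrightarrow> x = 0"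
  using pos[of x] by (cases "x = 0") (auto simp: g_simps)

lemma eqI: "(\<And>u. g x u = g y u) \<Longrightarrow> x = y"
  using g_self_eq_0_iff[of "x - y"] by (simp add: g_simps)

lemma orthonormal_sum:
  assumes "finite B" "\<forall>b\<in>B. \<forall>c\<in>B. g b c = (if b = c then 1 else 0)" "c \<in> B"
  shows "g (\<Sum>b\<in>B. f b *\<^sub>R b) c = f c"
proof -
  have "g (\<Sum>b\<in>B. f b *\<^sub>R b) c = (\<Sum>b\<in>B. f b * g b c)"
    by (simp add: linear_sum[OF linear_g(2)] g_simps)
  also have "\<dots> = (\<Sum>b\<in>B. if b = c then f b else 0)"
    using assms by (intro sum.cong) auto
  finally show ?thesis using assms by simp
qed

text \<open>Orthonormal sets are independent, so one of maximal size in \<open>S\<close> exists. A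
  vector of \<open>S\<close> outside its span would enlarge it by a Gram-Schmidt step.\<close>

lemma orthonormal_basis_exists:
  assumes S: "subspace S"
  shows "\<exists>B. finite B \<and> span B = S \<and> (\<forall>b\<in>B. \<forall>c\<in>B. g b c = (if b = c then 1 else 0))"
proof -
  define P where "P B \<longleftrightarrow> finite B \<and> B \<subseteq> S \<and>
    (\<forall>b\<in>B. \<forall>c\<in>B. g b c = (if b = c then 1 else 0))" for B
  have card_le: "card B \<le> DIM('a)" if "P B" for B
  proof -
    have "independent B"
      unfolding dependent_def
    proof (intro notI, elim bexE)
      fix b assume b: "b \<in> B" "b \<in> span (B - {b})"
      have "g b b = 0"
        by (rule linear_eq_0_on_span[OF linear_g(1) _ b(2)]) (use that b in \<open>auto simp: P_def\<close>)
      moreover have "g b b = 1" using that b by (auto simp: P_def)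
      ultimately show False by simp
    qed
    then show ?thesis using independent_bound by blast
  qed
  have "P {}" by (simp add: P_def)
  then obtain B where B: "P B" and max: "\<And>B'. P B' \<Longrightarrow> card B' \<le> card B"
    using ex_has_greatest_nat[of P "{}" card "Suc DIM('a)"] by (metis card_le less_Suc_eq_le)
  have sub: "span B \<subseteq> S" using B S span_minimal by (auto simp: P_def)
  have "x \<in> span B" if "x \<in> S" for x
  proof (rule ccontr)
    assume x: "x \<notin> span B"
    define p where "p = (\<Sum>b\<in>B. g x b *\<^sub>R b)"
    define y where "y = x - p"
    have p: "p \<in> span B" unfolding p_def by (intro span_sum span_scale span_base)
    then have "y \<noteq> 0" using x by (auto simp: y_def)
    then have ypos: "g y y > 0" by (rule pos)
    have orth: "g y b = 0" if "b \<in> B" for b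
      using orthonormal_sum[of B b "g x"] B that by (simp add: y_def p_def g_simps P_def)
    define e where "e = (1 / sqrt (g y y)) *\<^sub>R y"
    have ee: "g e e = 1" using ypos \<open>y \<noteq> 0\<close> by (simp add: e_def g_simps)
    have eb: "g e b = 0" if "b \<in> B" for b using orth[OF that] by (simp add: e_def g_simps)
    have be: "g b e = 0" if "b \<in> B" for b using eb[OF that] by (subst g_sym)
    have "e \<in> S" unfolding e_def y_def using p sub that S
      by (intro subspace_scale subspace_diff) auto
    moreover have "e \<notin> B" using eb ee by force
    ultimately have "P (insert e B)"
      using B ee eb be by (auto simp: P_def)
    from max[OF this] show False using \<open>e \<notin> B\<close> B by (simp add: P_def)
  qed
  then have "span B = S" using sub by auto
  with B show ?thesis by (auto simp: P_def)
qed

text \<open>The coordinates of \<open>p\<close> in an orthonormal basis of \<open>S\<close> are the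
  values of \<open>f\<close>. Besides the whole space, the centre of the Lie algebra serves as
  \<open>S\<close>.\<close>

lemma riesz_subspace:
  assumes "subspace S" "linear f"
  shows "\<exists>p\<in>S. \<forall>s\<in>S. g p s = f s"
proof -
  obtain B where B: "finite B" "span B = S" "\<forall>b\<in>B. \<forall>c\<in>B. g b c = (if b = c then 1 else 0)"
    using orthonormal_basis_exists[OF assms(1)] by blast
  let ?p = "\<Sum>b\<in>B. f b *\<^sub>R b"
  have "g ?p s = f s" if "s \<in> S" for s
    by (rule linear_eq_on_span[OF linear_g(1) assms(2), where B = B])
      (use B that orthonormal_sum in auto)
  moreover have "?p \<in> S" unfolding B(2)[symmetric] by (intro span_sum span_scale span_base)
  ultimately show ?thesis by blast
qed

lemma riesz: "linear f \<Longrightarrow> \<exists>v. \<forall>y. g v y = f y"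
  using riesz_subspace[of UNIV f] by auto

lemma orthonormal_frame_some: "orthonormal_frame g (SOME B. orthonormal_frame g B)"
proof (rule someI_ex)
  show "\<exists>B. orthonormal_frame g B"
    using orthonormal_basis_exists[OF subspace_UNIV] unfolding orthonormal_frame_def .
qed

text \<open>Both sides expand to the same double sum over matrix entries.\<close>

lemma trace_commute:
  assumes B: "orthonormal_frame g B" and S: "linear S" and T: "linear T"
  shows "(\<Sum>e\<in>B. g (S (T e)) e) = (\<Sum>e\<in>B. g (T (S e)) e)"
proof -
  have B': "finite B" "span B = UNIV" "\<forall>b\<in>B. \<forall>c\<in>B. g b c = (if b = c then 1 else 0)"
    using B by (auto simp: orthonormal_frame_def)
  have expand: "x = (\<Sum>b\<in>B. g x b *\<^sub>R b)" for x
  proof (rule eqI)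
    fix u
    show "g x u = g (\<Sum>b\<in>B. g x b *\<^sub>R b) u"
      by (rule linear_eq_on_span[OF linear_g(1) linear_g(1), where B = B])
        (use B' orthonormal_sum in auto)
  qed
  have *: "g (F (G e)) e = (\<Sum>f\<in>B. g (G e) f * g (F f) e)" if "linear F" for F G e
    by (subst expand[of "G e"]) (simp add: linear_sum[OF that] linear_scale[OF that]
        linear_sum[OF linear_g(2)] g_simps)
  have "(\<Sum>e\<in>B. g (S (T e)) e) = (\<Sum>e\<in>B. \<Sum>f\<in>B. g (T e) f * g (S f) e)"
    by (intro sum.cong refl *[OF S])
  also have "\<dots> = (\<Sum>f\<in>B. \<Sum>e\<in>B. g (S f) e * g (T e) f)"
    by (subst sum.swap) (simp only: mult.commute)
  also have "\<dots> = (\<Sum>f\<in>B. g (T (S f)) f)"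
    by (intro sum.cong refl *[OF T, symmetric])
  finally show ?thesis .
qed

end

section \<open>2-step nilpotent Lie algebras with a complex structure\<close>

locale complex_nilpotent =
  fixes br :: "'a::euclidean_space \<Rightarrow> 'a \<Rightarrow> 'a" and J :: "'a \<Rightarrow> 'a"
  assumes lie: "lie_algebra br"
    and nil: "two_step_nilpotent br"
    and cplx: "complex_structure br J"
begin

lemma bilinear_br: "bilinear br" using lie by (simp add: lie_algebra_def)

lemma linear_J: "linear J" using cplx by (simp add: complex_structure_def)

lemmas br_simps =
  bilinear_ladd[OF bilinear_br] bilinear_radd[OF bilinear_br]
  bilinear_lsub[OF bilinear_br] bilinear_rsub[OF bilinear_br]
  bilinear_lneg[OF bilinear_br] bilinear_rneg[OF bilinear_br]
  bilinear_lmul[OF bilinear_br] bilinear_rmul[OF bilinear_br]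
  bilinear_lzero[OF bilinear_br] bilinear_rzero[OF bilinear_br]

lemmas J_simps = linear_add[OF linear_J] linear_diff[OF linear_J] linear_neg[OF linear_J]
  linear_scale[OF linear_J] linear_0[OF linear_J]

lemma JJ [simp]: "J (J x) = - x" using cplx by (simp add: complex_structure_def)

lemma br_self [simp]: "br x x = 0" using lie by (simp add: lie_algebra_def)

lemma br_skew: "br x y = - br y x"
  using br_self[of "x + y"] by (simp add: br_simps add_eq_0_iff del: br_self) (simp add: add_eq_0_iff)

lemma br_br [simp]: "br (br x y) z = 0" "br z (br x y) = 0"
  using nil br_skew[of z "br x y"] by (simp_all add: two_step_nilpotent_def)

lemma nijenhuis: "br (J x) (J y) = J (br (J x) y) + J (br x (J y)) + br x y"
  using cplx by (simp add: complex_structure_def algebra_simps)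

definition central :: "'a \<Rightarrow> bool" where "central z \<longleftrightarrow> (\<forall>x. br z x = 0)"

lemma central_br [simp]: "central (br x y)" by (simp add: central_def)

lemma central_left: "central z \<Longrightarrow> br z x = 0" by (simp add: central_def)

lemma central_right: "central z \<Longrightarrow> br x z = 0" using br_skew[of x z] by (simp add: central_def)

lemma central_neg: "central z \<Longrightarrow> central (- z)" by (simp add: central_def br_simps)

text \<open>The Nijenhuis identity loses its two brackets with \<open>z\<close>; the rest says that
  bracketing with \<open>J z\<close> commutes with \<open>J\<close>.\<close>

lemma br_J_central: "central z \<Longrightarrow> br (J z) (J x) = J (br (J z) x)"
  using nijenhuis[of z x] by (simp add: central_left J_simps)

end

section \<open>The Bismut connection in closed form\<close>

locale hermitian_nilpotent = complex_nilpotent br J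
  for br :: "'a::euclidean_space \<Rightarrow> 'a \<Rightarrow> 'a" and J :: "'a \<Rightarrow> 'a" +
  fixes g :: "'a \<Rightarrow> 'a \<Rightarrow> real"
  assumes herm: "hermitian_metric J g"
begin

sublocale scalar_product g
  using herm by unfold_locales (auto simp: hermitian_metric_def)

lemma g_JJ [simp]: "g (J x) (J y) = g x y" using herm by (simp add: hermitian_metric_def)

lemma g_J: "g (J x) y = - g x (J y)"
  using g_JJ[of x "J y"] by (simp add: g_simps)

text \<open>Kaplan's map of a metric 2-step nilpotent Lie algebra, with \<open>z\<close> ranging
  over the whole algebra and not just the centre.\<close>

definition j :: "'a \<Rightarrow> 'a \<Rightarrow> 'a" where
  "j z x = (SOME v. \<forall>y. g v y = g z (br x y))"

lemma g_j: "g (j z x) y = g z (br x y)"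
proof -
  have "linear (\<lambda>y. g z (br x y))"
    using linear_compose[of "br x" "g z"] linear_g(1) bilinear_br
    by (simp add: bilinear_def o_def)
  from someI_ex[OF riesz[OF this]] show ?thesis by (simp add: j_def)
qed

lemma g_j': "g x (j z y) = - g (j z x) y"
  using br_skew[of y x] by (simp add: g_sym[of x] g_j g_simps)

lemma linear_j: "linear (j z)" "linear (\<lambda>z. j z x)"
  by (auto intro!: linearI eqI simp: g_j g_simps br_simps)

lemmas j_simps =
  linear_add[OF linear_j(1)] linear_diff[OF linear_j(1)] linear_neg[OF linear_j(1)]
  linear_scale[OF linear_j(1)] linear_0[OF linear_j(1)]
  linear_add[OF linear_j(2)] linear_diff[OF linear_j(2)] linear_neg[OF linear_j(2)]
  linear_scale[OF linear_j(2)] linear_0[OF linear_j(2)]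

lemma j_central: "central x \<Longrightarrow> j z x = 0"
  by (rule eqI) (simp add: g_j central_left g_simps)

text \<open>The terms free of \<open>J\<close> are the Levi-Civita connection from the Koszul
  formula; those with \<open>J\<close> are half the torsion found in
  \<open>torsion_bis\<close>.\<close>

definition bis :: "'a \<Rightarrow> 'a \<Rightarrow> 'a" where
  "bis x y = (1/2) *\<^sub>R (br x y - br (J x) (J y) - j x y + J (j x (J y)) - j y x - J (j y (J x)))"

lemma g_bis:
  "g (bis x y) z = (g (br x y) z - g (br (J x) (J y)) z - g x (br y z) - g x (br (J y) (J z))
     - g y (br x z) + g y (br (J x) (J z))) / 2"
  by (simp add: bis_def g_simps g_j g_J br_simps)

lemma bis_metric: "g (bis x y) z = - g y (bis x z)"
proof -
  have "g (bis x y) z + g (bis x z) y = 0"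
    unfolding g_bis using br_skew[of y z] br_skew[of "J y" "J z"]
    by (simp add: g_simps g_sym field_simps)
  then show ?thesis by (simp add: g_sym)
qed

lemma bis_J: "bis x (J y) = J (bis x y)"
proof (rule eqI)
  fix z
  \<comment> \<open>Integrability of \<open>J\<close>, paired with \<open>c\<close>, is what makes
    \<open>bis\<close> commute with \<open>J\<close>.\<close>
  have nj: "g c (br (J a) (J b)) = - g (J c) (br (J a) b) - g (J c) (br a (J b)) + g c (br a b)"
    for a b c
    by (simp add: nijenhuis[of a b] g_simps g_J)
  have "g (bis x (J y)) z + g (bis x y) (J z) = 0"
    unfolding g_bis
    using nj[of "J z" x y] nj[of "J y" x z] nj[of z x y] nj[of y x z]
    by (simp add: g_simps br_simps g_sym field_simps)
  then show "g (bis x (J y)) z = g (J (bis x y)) z" by (simp add: g_J)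
qed

text \<open>The right-hand side is d\<omega>(Jx, Jy, Jz) for the fundamental form \<omega>, hence a
  3-form.\<close>

lemma torsion_bis:
  "g (torsion br bis x y) z = - g (br (J x) (J y)) z - g (br (J y) (J z)) x - g (br (J z) (J x)) y"
  unfolding torsion_def g_simps g_bis
  using br_skew[of x y] br_skew[of "J y" "J x"] br_skew[of "J z" "J x"]
  by (simp add: g_simps g_sym field_simps)

lemma bilinear_bis: "bilinear bis"
  unfolding bilinear_def
  by (auto intro!: linearI simp: bis_def br_simps j_simps J_simps algebra_simps)

lemma is_bismut_connection_bis: "is_bismut_connection br J g bis"
proof -
  have skew12: "g (torsion br bis x y) z = - g (torsion br bis y x) z" for x y z
    unfolding torsion_bis
    using br_skew[of "J y" "J x"] br_skew[of "J z" "J x"] br_skew[of "J z" "J y"]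
    by (simp add: g_simps)
  have skew23: "g (torsion br bis x y) z = - g (torsion br bis x z) y" for x y z
    unfolding torsion_bis
    using br_skew[of "J y" "J x"] br_skew[of "J z" "J x"] br_skew[of "J z" "J y"]
    by (simp add: g_simps)
  have "g (bis x y) z + g y (bis x z) = 0" for x y z by (simp add: bis_metric)
  then show ?thesis
    unfolding is_bismut_connection_def
    by (intro conjI allI bilinear_bis bis_J skew12 skew23)
qed

lemma is_bismut_connectionD:
  assumes "is_bismut_connection br J g D"
  shows "g (D x y) z + g y (D x z) = 0"
    and "D x (J y) = J (D x y)"
    and "g (torsion br D x y) z = - g (torsion br D x z) y"
proof -
  note D = assms[unfolded is_bismut_connection_def]
  show "g (D x y) z + g y (D x z) = 0"
    by (rule D[THEN conjunct2, THEN conjunct1, rule_format])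
  show "D x (J y) = J (D x y)"
    by (rule D[THEN conjunct2, THEN conjunct2, THEN conjunct1, rule_format])
  show "g (torsion br D x y) z = - g (torsion br D x z) y"
    by (rule D[THEN conjunct2, THEN conjunct2, THEN conjunct2, THEN conjunct2, rule_format])
qed

text \<open>The difference of two Bismut connections is a 3-form \<open>e\<close> with \<open>e(x, Jy, z) = - e(x, y, Jz)\<close>;
  moving \<open>J\<close> around the three slots changes the sign an odd number of times.\<close>

lemma is_bismut_connection_unique:
  assumes D: "is_bismut_connection br J g D" and D': "is_bismut_connection br J g D'"
  shows "D = D'"
proof -
  define e where "e x y z = g (D x y - D' x y) z" for x y z
  note met = is_bismut_connectionD(1)[OF D] is_bismut_connectionD(1)[OF D']
  note J = is_bismut_connectionD(2)[OF D] is_bismut_connectionD(2)[OF D']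
  note skew = is_bismut_connectionD(3)[OF D] is_bismut_connectionD(3)[OF D']
  have s23: "e x y z = - e x z y" for x y z
    using met(1)[of x y z] met(2)[of x y z] g_sym[of "D x z" y] g_sym[of "D' x z" y]
    by (simp add: e_def g_simps)
  have tor: "e x y z - e y x z = g (torsion br D x y) z - g (torsion br D' x y) z" for x y z
    by (simp add: e_def torsion_def g_simps)
  have t23: "e x y z - e y x z = - (e x z y - e z x y)" for x y z
    unfolding tor using skew(1)[of x y z] skew(2)[of x y z] by linarith
  have s12: "e x y z = - e y x z" for x y z
    using t23[of x y z] t23[of y x z] s23[of x y z] s23[of y x z] s23[of z x y] t23[of z x y]
    by linarith
  have eJ: "e x (J y) z = - e x y (J z)" for x y z
    by (simp add: e_def J g_simps g_J)
  have "e (J x) y z = 0" for x y z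
    using s12[of "J x" y z] eJ[of y x z] s12[of y x "J z"] eJ[of x y z] s23[of x "J y" z]
      s23[of "J x" y z] s12[of "J x" z y] eJ[of z x y] s12[of z x "J y"] by linarith
  from this[of "- J _"] have "e x y z = 0" for x y z by (simp add: J_simps)
  then have "D x y = D' x y" for x y
    by (intro eqI) (simp add: e_def g_simps)
  then show ?thesis by blast
qed

lemma bismut_connection_eq: "bismut_connection br J g = bis"
  unfolding bismut_connection_def
  by (blast intro: is_bismut_connection_bis is_bismut_connection_unique)

lemmas bis_simps =
  bilinear_ladd[OF bilinear_bis] bilinear_radd[OF bilinear_bis]
  bilinear_lsub[OF bilinear_bis] bilinear_rsub[OF bilinear_bis]
  bilinear_lneg[OF bilinear_bis] bilinear_rneg[OF bilinear_bis]
  bilinear_lmul[OF bilinear_bis] bilinear_rmul[OF bilinear_bis]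
  bilinear_lzero[OF bilinear_bis] bilinear_rzero[OF bilinear_bis]

section \<open>Curvature and consequences of the Bianchi identity\<close>

abbreviation R :: "'a \<Rightarrow> 'a \<Rightarrow> 'a \<Rightarrow> 'a" where "R \<equiv> bismut_curvature br J g"

lemma R_eq: "R x y z = bis x (bis y z) - bis y (bis x z) - bis (br x y) z"
  by (simp add: bismut_curvature_def curvature_def bismut_connection_eq)

lemma R_J: "R x y (J z) = J (R x y z)"
  by (simp add: R_eq bis_J J_simps)

lemma g_R:
  "g (R x y z) u = g (bis x z) (bis y u) - g (bis y z) (bis x u) - g (bis (br x y) z) u"
  by (simp add: R_eq g_simps bis_metric[of x "bis y z" u] bis_metric[of y "bis x z" u])

text \<open>The classical Riemannian argument: skew-symmetry in each pair, which any metric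
  connection has, combined with four instances of the Bianchi identity.\<close>

lemma R_pair_symmetry:
  assumes bianchi: "\<And>x y z. R x y z + R y z x + R z x y = 0"
  shows "g (R x y z) u = g (R z u x) y"
proof -
  have s12: "g (R x y z) u = - g (R y x z) u" for x y z u
    using br_skew[of x y] by (simp add: g_R g_simps bis_simps)
  have s34: "g (R x y z) u = - g (R x y u) z" for x y z u
    using bis_metric[of "br x y" z u] g_sym[of z "bis (br x y) u"]
      g_sym[of "bis x z" "bis y u"] g_sym[of "bis y z" "bis x u"]
    unfolding g_R by linarith
  have b: "g (R x y z) u + g (R y z x) u + g (R z x y) u = 0" for x y z u
    using arg_cong[OF bianchi[of x y z], of "\<lambda>v. g v u"] by (simp add: g_simps)
  show ?thesis
    using b[of x y z u] b[of y z u x] b[of z u x y] b[of u x y z]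
      s12[of z x y u] s12[of y z u x] s12[of u x y z] s12[of u y z x] s12[of z u x y] s12[of u x z y]
      s34[of x y z u] s34[of y z x u] s34[of z x y u] s34[of z u x y] s34[of u x y z] s34[of u y z x]
      s12[of x u z y] s34[of x z y u] s12[of x z y u] s34[of y u z x] s12[of y u z x] s34[of x u y z]
    by linarith
qed

text \<open>With \<open>w = [Jz, x]\<close> and \<open>v = j w (Jz)\<close>, the two curvature components \<open>R(w, Jw, z, Jz)\<close> and
  \<open>R(z, Jz, w, Jw)\<close> are \<open>-|v|\<^sup>2/2\<close> and \<open>|v|\<^sup>2/2\<close>, so pair symmetry gives \<open>v = 0\<close> and \<open>|w|\<^sup>2 = g v x = 0\<close>.\<close>

lemma central_J_if_bianchi:
  assumes bianchi: "\<And>x y z. R x y z + R y z x + R z x y = 0" and z: "central z"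
  shows "central (J z)"
  unfolding central_def
proof
  fix x
  define w where "w = br (J z) x"
  \<comment> \<open>By \<open>br_J_central\<close>, \<open>J w\<close> is the bracket of
    \<open>J z\<close> and \<open>J x\<close>, hence central.\<close>
  have w: "central w" "central (J w)"
    using br_J_central[OF z, of x] by (simp_all add: w_def flip: br_J_central[OF z])
  define v where "v = j w (J z)"
  have jv: "j (J w) (J z) = J v"
  proof (rule eqI)
    fix u
    have "g (j (J w) (J z)) u = - g w (br (J z) (J u))"
      by (simp add: g_j g_J br_J_central[OF z])
    also have "\<dots> = g (J v) u" by (simp add: v_def g_j g_J)
    finally show "g (j (J w) (J z)) u = g (J v) u" .
  qed
  note [simp] = z w central_left central_right j_central central_neg
  have wz: "bis w z = (1/2) *\<^sub>R J v" by (simp add: bis_def v_def J_simps)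
  have zw: "bis z w = - (1/2) *\<^sub>R J v" by (simp add: bis_def v_def J_simps)
  have Jzw: "bis (J z) w = - (1/2) *\<^sub>R v" by (simp add: bis_def v_def J_simps br_simps j_simps)
  have Jwz: "bis (J w) z = - (1/2) *\<^sub>R v" by (simp add: bis_def jv J_simps br_simps j_simps)
  have "g (R w (J w) z) (J z) = - (1/2) * g v v"
    by (simp add: g_R bis_J wz Jwz g_simps J_simps bis_simps)
  moreover have "g (R z (J z) w) (J w) = (1/2) * g v v"
    by (simp add: g_R bis_J zw Jzw g_simps J_simps bis_simps)
  ultimately have "g v v = 0" using R_pair_symmetry[OF bianchi, of w "J w" z "J z"] by simp
  then have "v = 0" by simp
  then have "g w (br (J z) x) = 0" using g_j[of w "J z" x] by (simp add: v_def g_simps)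
  then show "br (J z) x = 0" by (simp add: w_def)
qed

text \<open>For central \<open>z\<close>, let \<open>E\<close> be the part of \<open>j z\<close> that anticommutes with \<open>J\<close>. In the Bianchi identity for
  \<open>z, Jz, x\<close> the first term is complex linear in \<open>x\<close> and the other two are antilinear, so
  \<open>R(z, Jz) = 0\<close>, whereas \<open>R(x, Jx, z, Jz) = 2 |E x|\<^sup>2\<close>.\<close>

lemma abelian_if_bianchi:
  assumes bianchi: "\<And>x y z. R x y z + R y z x + R z x y = 0"
  shows "br (J x) (J y) = br x y"
proof -
  have *: "g z (br (J x) (J y)) = g z (br x y)" if z: "central z" for z x y
  proof -
    note J_central = central_J_if_bianchi[OF bianchi]
    note [simp] = z J_central central_left central_right j_central central_neg
    define E where "E x = (1/2) *\<^sub>R (j z x + J (j z (J x)))" for x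
    have E_bis: "bis x z = - E x" for x by (simp add: bis_def E_def J_simps algebra_simps)
    have E_J: "E (J x) = - J (E x)" for x
      by (simp add: E_def J_simps j_simps scaleR_diff_right algebra_simps)
    have E_central: "E x = 0" if "central x" for x using that by (simp add: E_def J_simps)
    have E0: "E 0 = 0" by (simp add: E_def J_simps j_simps)
    have bzz: "bis z z = 0" "bis (J z) z = 0" by (simp_all add: bis_def J_simps)
    have "R z (J z) x = 0" for x
    proof -
      define P where "P x = R (J z) x z + R x z (J z)" for x
      have P: "P x = - bis (J z) (E x) + J (bis z (E x))" for x
        by (simp add: P_def R_eq E_bis E_central E0 bis_J bzz bis_simps J_simps)
      have PJ: "P (J x) = - J (P x)"
        by (simp add: P E_J bis_J bis_simps J_simps)
      have RP: "R z (J z) x = - P x" for x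
        using bianchi[of z "J z" x] by (simp add: P_def add_eq_0_iff add.assoc)
      have "J (R z (J z) x) = - J (R z (J z) x)"
        using RP[of x] RP[of "J x"] PJ by (simp add: R_J J_simps)
      then have "2 *\<^sub>R J (R z (J z) x) = 0" by (metis add.left_inverse scaleR_2)
      then have "J (R z (J z) x) = 0" by simp
      then show ?thesis by (metis JJ linear_0[OF linear_J] neg_equal_0_iff_equal)
    qed
    then have "g (R x (J x) z) (J z) = 0"
      using R_pair_symmetry[OF bianchi, of x "J x" z "J z"] by (simp add: g_simps)
    moreover have "g (R x (J x) z) (J z) = 2 * g (E x) (E x)"
      by (simp add: g_R E_bis bis_J E_J E_central g_simps J_simps)
    ultimately have "E x = 0" by simp
    then have "j z x + J (j z (J x)) = 0" by (simp add: E_def)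
    from arg_cong[OF this, of "\<lambda>v. g v y"] show ?thesis by (simp add: g_simps g_J g_j)
  qed
  \<comment> \<open>The defect \<open>c\<close> is a difference of brackets, hence central, so
    \<open>*\<close> can be tested against \<open>c\<close> itself.\<close>
  define c where "c = br (J x) (J y) - br x y"
  have "central c" by (simp add: c_def central_def br_simps)
  from *[OF this, of x y] have "g c c = 0" by (simp add: c_def g_simps)
  then show ?thesis by (simp add: c_def)
qed

end

section \<open>Abelian complex structures\<close>

locale abelian_hermitian_nilpotent = hermitian_nilpotent br J g
  for br :: "'a::euclidean_space \<Rightarrow> 'a \<Rightarrow> 'a" and J :: "'a \<Rightarrow> 'a" and g +
  assumes abelian: "br (J x) (J y) = br x y"
begin

lemma br_J: "br (J x) y = - br x (J y)"
  using abelian[of x "J y"] by (simp add: br_simps minus_equation_iff)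

text \<open>In \<open>g_bis\<close>, the terms in [x, y] and [x, z] cancel against their
  \<open>J\<close> counterparts, while those in [y, z] double.\<close>

lemma bis_eq: "bis x y = - j x y"
proof (rule eqI)
  fix z show "g (bis x y) z = g (- j x y) z"
    unfolding g_bis by (simp add: abelian g_simps g_j)
qed

lemma j_J: "j z (J x) = J (j z x)"
  by (rule eqI) (simp add: g_j g_J br_J g_simps)

lemma R_abelian: "R x y z = j x (j y z) - j y (j x z) + j (br x y) z"
  by (simp add: R_eq bis_eq j_simps)

text \<open>Take for \<open>p\<close> the orthogonal projection of \<open>x\<close> to the centre:
  \<open>j x\<close> sees \<open>x\<close> only through its products with brackets, which are
  central.\<close>

lemma j_projection: "\<exists>p. central p \<and> j p = j x"
proof -
  have "subspace {z. central z}" by (auto simp: subspace_def central_def br_simps)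
  from riesz_subspace[OF this linear_g(1)[of x]]
  obtain p where p: "central p" "\<And>s. central s \<Longrightarrow> g p s = g x s" by auto
  then have "j p = j x" by (intro ext eqI) (simp add: g_j)
  with p show ?thesis by blast
qed

lemma strominger_kahler_like_iff:
  "strominger_kahler_like br J g \<longleftrightarrow>
    (\<forall>x y z. j x (j y z) = j y (j x z)) \<and>
    (\<forall>x y u v. g (br x y) (br u v) + g (br y u) (br x v) + g (br u x) (br y v) = 0)"
  (is "?L \<longleftrightarrow> ?A \<and> ?B")
proof
  assume ?L
  then have bianchi: "R x y z + R y z x + R z x y = 0" for x y z
    by (simp add: strominger_kahler_like_def Let_def)
  have ?A
  proof (intro allI)
    fix x y z
    \<comment> \<open>For central \<open>p\<close> and \<open>q\<close>, every term of the Bianchi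
      identity vanishes except the commutator of \<open>j p\<close> and \<open>j q\<close>.\<close>
    obtain p q where pq: "central p" "j p = j x" "central q" "j q = j y"
      using j_projection by metis
    have "j p (j q z) - j q (j p z) = 0"
      using bianchi[of p q z] pq(1,3)
      by (simp add: R_abelian central_left central_right j_central j_simps)
    then show "j x (j y z) = j y (j x z)" by (simp add: pq)
  qed
  moreover have ?B
  proof (intro allI)
    fix x y u v
    have "j (br x y) u + j (br y u) x + j (br u x) y = 0"
      using bianchi[of x y u] \<open>?A\<close> by (simp add: R_abelian)
    from arg_cong[OF this, of "\<lambda>w. g w v"]
    show "g (br x y) (br u v) + g (br y u) (br x v) + g (br u x) (br y v) = 0"
      by (simp add: g_simps g_j)
  qed
  ultimately show "?A \<and> ?B" ..
next
  assume AB: "?A \<and> ?B"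
  \<comment> \<open>With the commutator gone, condition (ii) is abelianness of \<open>J\<close>, and
    the Bianchi identity paired with a vector is \<open>?B\<close>.\<close>
  then have R: "R x y z = j (br x y) z" for x y z by (simp add: R_abelian)
  have "R x y z + R y z x + R z x y = 0" for x y z
    by (rule eqI) (use AB in \<open>simp add: R g_simps g_j\<close>)
  then show ?L by (simp add: strominger_kahler_like_def Let_def R abelian)
qed

text \<open>The commutator part of the curvature is traceless against \<open>J\<close>.\<close>

lemma bismut_ricci_form_eq: "\<exists>w. \<forall>x y. bismut_ricci_form br J g x y = g w (br x y)"
proof -
  define B where "B = (SOME B. orthonormal_frame g B)"
  have B: "orthonormal_frame g B" unfolding B_def by (rule orthonormal_frame_some)
  define w where "w = (1/2) *\<^sub>R (\<Sum>e\<in>B. br (J e) e)"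
  have "bismut_ricci_form br J g x y = g w (br x y)" for x y
  proof -
    have lin: "linear (\<lambda>e. j y (J e))"
      using linear_compose[OF linear_J linear_j(1)[of y]] by (simp add: o_def)
    have tr: "(\<Sum>e\<in>B. g (j x (j y (J e))) e) = (\<Sum>e\<in>B. g (j y (j x (J e))) e)"
      using trace_commute[OF B linear_j(1)[of x] lin] by (simp add: j_J)
    have "(\<Sum>e\<in>B. g (R x y (J e)) e) = (\<Sum>e\<in>B. g (br x y) (br (J e) e))"
      using tr by (simp add: R_abelian g_simps sum.distrib sum_subtractf g_j)
    also have "\<dots> = g (br x y) (\<Sum>e\<in>B. br (J e) e)"
      by (simp add: linear_sum[OF linear_g(1)])
    finally show ?thesis
      by (simp add: bismut_ricci_form_def B_def[symmetric] w_def g_simps g_sym)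
  qed
  then show ?thesis by blast
qed

end

section \<open>The pluriclosed flow\<close>

theorem theorem1p2:
  fixes br :: "'a::euclidean_space \<Rightarrow> 'a \<Rightarrow> 'a"
    and J :: "'a \<Rightarrow> 'a"
    and g\<^sub>0 :: "'a \<Rightarrow> 'a \<Rightarrow> real"
    and g :: "real \<Rightarrow> 'a \<Rightarrow> 'a \<Rightarrow> real"
    and I :: "real set"
  assumes "lie_algebra br"
    and "two_step_nilpotent br"
    and "complex_structure br J"
    and "hermitian_metric J g\<^sub>0"
    and "strominger_kahler_like br J g\<^sub>0"
    and "pluriclosed_flow br J g\<^sub>0 I g"
  shows "\<forall>t\<in>I. strominger_kahler_like br J (g t)"
proof
  fix t assume t: "t \<in> I"
  interpret H: hermitian_nilpotent br J g\<^sub>0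
    using assms by unfold_locales
  have "H.R x y z + H.R y z x + H.R z x y = 0" for x y z
    using assms(5) by (simp add: strominger_kahler_like_def Let_def)
  note abelian = H.abelian_if_bianchi[OF this]
  interpret G0: abelian_hermitian_nilpotent br J g\<^sub>0
    by unfold_locales (rule abelian)
  have G: "abelian_hermitian_nilpotent br J (g s)" if "s \<in> I" for s
    using assms that abelian by unfold_locales (auto simp: pluriclosed_flow_def)
  interpret Gt: abelian_hermitian_nilpotent br J "g t" by (rule G[OF t])
  have flow: "is_interval I" "0 \<in> I" "g 0 = g\<^sub>0" using assms by (auto simp: pluriclosed_flow_def)
  have deriv: "\<exists>w. \<forall>x y. ((\<lambda>s. g s x y) has_real_derivative g s w (br (J x) y)) (at s within I)"
    if s: "s \<in> I" for s
  proof -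
    interpret Gs: abelian_hermitian_nilpotent br J "g s" by (rule G[OF s])
    obtain w where w: "\<And>x y. bismut_ricci_form br J (g s) x y = g s w (br x y)"
      using Gs.bismut_ricci_form_eq by blast
    have "((\<lambda>s. g s x y) has_real_derivative g s w (br (J x) y)) (at s within I)" for x y
    proof -
      \<comment> \<open>Inserting \<open>- J x\<close> turns the fundamental form back into the
        metric. The Ricci form equals its (1,1)-part because \<open>J\<close> is abelian.\<close>
      have "((\<lambda>r. fundamental_form J (g r) (- J x) y) has_real_derivative
           - part_1_1 J (bismut_ricci_form br J (g s)) (- J x) y) (at s within I)"
        using assms(6) s by (auto simp: pluriclosed_flow_def)
      then show ?thesis
        by (simp add: fundamental_form_def part_1_1_def w abelian H.J_simps H.br_simps
            Gs.g_simps G0.br_J)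
    qed
    then show ?thesis by blast
  qed
  have const: "f s = f 0" if "s \<in> I" "\<And>s. s \<in> I \<Longrightarrow> (f has_real_derivative 0) (at s within I)"
    for f :: "real \<Rightarrow> real" and s
    using has_field_derivative_zero_constant[of I f] that flow is_interval_convex by metis
  \<comment> \<open>The derivative pairs \<open>w\<close> with a bracket that has a bracket as an
    argument, which is 0 by 2-step nilpotency.\<close>
  have g_br: "g s x (br u v) = g\<^sub>0 x (br u v)" if "s \<in> I" for s x u v
  proof -
    have "((\<lambda>s. g s x (br u v)) has_real_derivative 0) (at s within I)" if s: "s \<in> I" for s
    proof -
      interpret Gs: abelian_hermitian_nilpotent br J "g s" by (rule G[OF s])
      obtain w where "((\<lambda>s. g s x (br u v)) has_real_derivative g s w (br (J x) (br u v))) (at s within I)"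
        using deriv[OF s] by blast
      then show ?thesis by (simp add: Gs.g_simps)
    qed
    from const[OF \<open>s \<in> I\<close> this] show ?thesis by (simp add: flow)
  qed
  have A0: "H.j x (H.j y z) = H.j y (H.j x z)" for x y z
    using assms(5) by (simp add: G0.strominger_kahler_like_iff)
  have skew: "g t (H.j z x) y + g t x (H.j z y) = 0" for x y z
  proof -
    have "((\<lambda>s. g s (H.j z x) y + g s x (H.j z y)) has_real_derivative 0) (at s within I)"
      if s: "s \<in> I" for s
    proof -
      obtain w where w: "\<And>x y. ((\<lambda>s. g s x y) has_real_derivative g s w (br (J x) y)) (at s within I)"
        using deriv[OF s] by blast
      \<comment> \<open>By \<open>g_br\<close> the derivative can be computed with the initial
        metric. There \<open>H.j z\<close> is skew and commutes with \<open>J\<close> and with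
        \<open>H.j w\<close>, so the two terms cancel.\<close>
      have "g s w (br (J (H.j z x)) y) + g s w (br (J x) (H.j z y)) =
          g\<^sub>0 (H.j w (J (H.j z x))) y + g\<^sub>0 (H.j w (J x)) (H.j z y)"
        by (simp add: g_br[OF s] H.g_j)
      also have "\<dots> = 0"
        by (simp add: H.g_j' G0.j_J A0[of w z])
      finally show ?thesis using DERIV_add[OF w w] by metis
    qed
    from const[OF t this] show ?thesis by (simp add: flow H.g_j')
  qed
  have "\<exists>v. \<forall>y. g\<^sub>0 v y = g t x y" for x by (rule H.riesz) (rule Gt.linear_g)
  \<comment> \<open>\<open>h\<close> represents the metric at time \<open>t\<close> relative to the
    initial one; it is injective as that metric is nondegenerate.\<close>
  then obtain h where h: "\<And>x y. g\<^sub>0 (h x) y = g t x y" by metis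
  have inj: "x = y" if "h x = h y" for x y
    by (rule Gt.eqI) (metis h that)
  have h_jt: "h (Gt.j z x) = H.j z x" for x z
    by (rule H.eqI) (simp add: h Gt.g_j H.g_j g_br[OF t])
  have h_j0: "h (H.j z x) = H.j z (h x)" for x z
  proof (rule H.eqI)
    fix y
    have "g\<^sub>0 (h (H.j z x)) y = - g\<^sub>0 (h x) (H.j z y)" using skew[of z x y] by (simp add: h)
    then show "g\<^sub>0 (h (H.j z x)) y = g\<^sub>0 (H.j z (h x)) y" by (simp add: H.g_j')
  qed
  \<comment> \<open>Each \<open>h\<close> converts one factor \<open>Gt.j\<close> into
    \<open>H.j\<close>, so two of them reduce the claim to \<open>A0\<close>.\<close>
  have "h (h (Gt.j x (Gt.j y z))) = h (h (Gt.j y (Gt.j x z)))" for x y z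
    by (simp add: h_jt h_j0 A0[of x y])
  then have "Gt.j x (Gt.j y z) = Gt.j y (Gt.j x z)" for x y z by (blast intro: inj)
  then show "strominger_kahler_like br J (g t)"
    using assms(5) by (simp add: Gt.strominger_kahler_like_iff G0.strominger_kahler_like_iff g_br[OF t])
qed

end
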